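(* Let $(X,\rho)$ be a linear metric space. If $(CL(X),W_\rho)$ is normal, then $X$ is separable.
   Context: A linear metric space is a (real or complex) vector space $X$ equipped with a metric $\rho$ for whose topology vector addition and scalar multiplication are continuous. $CL(X)$ is the set of all nonempty closed subsets of $X$. For $x\in X$ and $A\in CL(X)$ put $\rho(x,A)=\inf\{\rho(x,a): a\in A\}$. The Wijsman topology $W_\rho$ is the weakest topology on $CL(X)$ for which all the functions $A\mapsto \rho(x,A)$, $x\in X$, are continuous. *)

theory Defs
  imports "HOL-Analysis.Analysis"
begin

text \<open>
  The metric is the \<^const>\<open>dist\<close> of class \<^class>\<open>metric_space\<close> and is not assumed to be translation invariant.
  The scalar field ranges over the class \<^class>\<open>real_normed_field\<close>, whose norm is multiplicative; by
  the theorem of Mazur its members are, up to isometric isomorphism, exactly the real and the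
  complex numbers, so real and complex spaces are both covered.
\<close>

locale linear_metric_space = vector_space scale
  for scale :: "'k::real_normed_field \<Rightarrow> 'a::{ab_group_add, metric_space} \<Rightarrow> 'a" +
  assumes continuous_add: "continuous_on UNIV (\<lambda>(x :: 'a, y). x + y)"
    and continuous_scale: "continuous_on UNIV (\<lambda>(c, x). scale c x)"

definition CL :: "'a::topological_space set set"
  where "CL = {A. closed A \<and> A \<noteq> {}}"

definition wijsman_topology :: "'a::metric_space set topology"
  where "wijsman_topology =
    topology_generated_by {{A \<in> CL. infdist x A \<in> U} | x U. open U}"

lemma topspace_wijsman [simp]: "topspace (wijsman_topology :: 'a::metric_space set topology) = CL"
  unfolding wijsman_topology_def topology_generated_by_topspace by (auto intro: open_UNIV)

lemma continuous_map_infdist_wijsman: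
  "continuous_map wijsman_topology euclideanreal (infdist x)"
  unfolding continuous_map_def topspace_wijsman
  by (auto simp: wijsman_topology_def intro!: topology_generated_by_Basis)

lemma wijsman_topology_weakest:
  fixes T :: "'a::metric_space set topology"
  assumes top: "topspace T = CL"
    and cont: "\<And>x. continuous_map T euclideanreal (infdist x)"
    and V: "openin wijsman_topology V"
  shows "openin T V"
proof (rule generate_topology_on_coarsest)
  show "istopology (openin T)" by simp
  show "generate_topology_on {{A \<in> CL. infdist x A \<in> U} | (x :: 'a) U. open U} V"
    using V unfolding wijsman_topology_def by (rule openin_topology_generated_by)
  show "openin T S" if "S \<in> {{A \<in> CL. infdist x A \<in> U} | (x :: 'a) U. open U}" for S
    using that cont by (auto simp: continuous_map_def top)
qed

end

theory Submission
  imports Defs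
begin

text \<open>
  The proof is by contraposition: if \<open>X\<close> is not separable, then the hyperspace contains a closed
  copy of the product \<open>\<nat>\<^sup>C\<close> of uncountably many discrete countable spaces, which is not normal by a
  classical theorem of A. H. Stone (\<open>not_normal_nat_power\<close>), whereas normality passes to closed
  subspaces.

  The copy arises as follows. A nonseparable metric space contains, for some \<open>r > 0\<close>, an uncountable
  set \<open>C\<close> of points with mutual distances at least \<open>4r\<close>. Punch out the balls of radius \<open>r\<close>
  around the points of \<open>C\<close>, and put exactly one point \<open>p c (f c)\<close> back into each hole, chosen
  by \<open>f \<in> \<nat>\<^sup>C\<close> from a sequence \<open>p c\<close> in the ball of radius \<open>r/2\<close> around \<open>c\<close> whose terms have
  mutual distances bounded away from \<open>0\<close>. The linear structure enters twice.

  \<^item> Balls are not separable, since otherwise their dilations would make \<open>X\<close> separable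
    (\<open>separable_if_ball_separable\<close>); this provides the sequences \<open>p c\<close>.

  \<^item> Line segments are connected, so every sphere of radius \<open>r\<close> around a point of \<open>C\<close> is
    nonempty (\<open>sphere_nonempty\<close>). From a point \<open>x\<close> of a hole, this sphere, which lies in every
    filled set, is closer than the points chosen in the other holes, and the distance from \<open>x\<close> to the filled set depends on the
    single coordinate of \<open>f\<close> that belongs to the hole of \<open>x\<close> (\<open>infdist_fill_cong\<close>).

  The second point makes the map \<open>f \<mapsto> fill f\<close> continuous for the product topology. That it is a
  closed map comes from the radii \<open>r/2 < r\<close>: a limit of filled sets has distance at most \<open>r/2\<close> from
  the centre of each hole, so it still has a point in the hole, and as the terms of \<open>p c\<close> do not
  accumulate anywhere, this point is again a term of \<open>p c\<close> and is the only point in the hole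
  (\<open>limit_eq_fill\<close>).
\<close>

section \<open>Uncountable powers of the discrete space of natural numbers\<close>

abbreviation nat_power :: "'i set \<Rightarrow> ('i \<Rightarrow> nat) topology"
  where "nat_power I \<equiv> product_topology (\<lambda>_. discrete_topology UNIV) I"

text \<open>
  Openness in a power of a discrete space, without mentioning boxes: membership in an open set is
  secured by finitely many coordinates.
\<close>

lemma openin_nat_power_iff:
  "openin (nat_power I) S \<longleftrightarrow>
    S \<subseteq> extensional I \<and>
    (\<forall>f\<in>S. \<exists>J. finite J \<and> J \<subseteq> I \<and> (\<forall>g\<in>extensional I. (\<forall>i\<in>J. g i = f i) \<longrightarrow> g \<in> S))"
  (is "_ \<longleftrightarrow> ?ext \<and> ?fin")
proof
  assume S: "openin (nat_power I) S"
  have "\<exists>J. finite J \<and> J \<subseteq> I \<and> (\<forall>g\<in>extensional I. (\<forall>i\<in>J. g i = f i) \<longrightarrow> g \<in> S)" if f: "f \<in> S" for f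
  proof -
    obtain U where U: "finite {i \<in> I. U i \<noteq> UNIV}" "f \<in> PiE I U" "PiE I U \<subseteq> S"
      using S f unfolding openin_product_topology_alt by auto
    have "g \<in> PiE I U" if "g \<in> extensional I" "\<forall>i\<in>{i \<in> I. U i \<noteq> UNIV}. g i = f i" for g
    proof (rule PiE_I)
      show "g i \<in> U i" if "i \<in> I" for i
        using \<open>\<forall>i\<in>_. g i = f i\<close> PiE_mem[OF U(2) that] that by (cases "U i = UNIV") auto
    qed (use \<open>g \<in> extensional I\<close> in \<open>simp add: extensional_def\<close>)
    then show ?thesis using U(1) subsetD[OF U(3)]
      by (intro exI[of _ "{i \<in> I. U i \<noteq> UNIV}"]) blast
  qed
  moreover have "S \<subseteq> extensional I"
    using openin_subset[OF S] by (auto simp: PiE_iff)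
  ultimately show "?ext \<and> ?fin" by blast
next
  assume R: "?ext \<and> ?fin"
  show "openin (nat_power I) S"
    unfolding openin_product_topology_alt
  proof
    fix f assume f: "f \<in> S"
    then obtain J where J: "finite J" "J \<subseteq> I" "\<And>g. g \<in> extensional I \<Longrightarrow> \<forall>i\<in>J. g i = f i \<Longrightarrow> g \<in> S"
      using R by meson
    let ?U = "\<lambda>i. if i \<in> J then {f i} else UNIV"
    have "finite {i \<in> I. ?U i \<noteq> UNIV}"
      by (rule finite_subset[OF _ J(1)]) auto
    moreover have "f \<in> PiE I ?U"
      using f R by (auto simp: PiE_iff)
    moreover have "PiE I ?U \<subseteq> S"
    proof
      fix g assume g: "g \<in> PiE I ?U"
      have "g i = f i" if "i \<in> J" for i
        using PiE_mem[OF g, of i] that J(2) by auto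
      then show "g \<in> S" using J(3) g by (auto simp: PiE_iff)
    qed
    ultimately show "\<exists>U. finite {i \<in> I. U i \<noteq> topspace (discrete_topology UNIV)} \<and>
        (\<forall>i\<in>I. openin (discrete_topology UNIV) (U i)) \<and> f \<in> PiE I U \<and> PiE I U \<subseteq> S"
      by (intro exI[of _ ?U]) simp
  qed
qed

text \<open>
  The sets \<open>inj_off I 0\<close> and \<open>inj_off I 1\<close> are Stone's two closed sets that cannot be separated.
\<close>

definition inj_off :: "'i set \<Rightarrow> nat \<Rightarrow> ('i \<Rightarrow> nat) set"
  where "inj_off I k = {f \<in> extensional I. inj_on f {i \<in> I. f i \<noteq> k}}"

lemma closedin_inj_off: "closedin (nat_power I) (inj_off I k)"
proof -
  have "openin (nat_power I) (extensional I - inj_off I k)"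
    unfolding openin_nat_power_iff
  proof (intro conjI ballI)
    fix f assume "f \<in> extensional I - inj_off I k"
    then obtain i j where ij: "i \<in> I" "j \<in> I" "i \<noteq> j" "f i = f j" "f i \<noteq> k"
      by (auto simp: inj_off_def inj_on_def)
    then show "\<exists>J. finite J \<and> J \<subseteq> I \<and>
        (\<forall>g\<in>extensional I. (\<forall>i\<in>J. g i = f i) \<longrightarrow> g \<in> extensional I - inj_off I k)"
      by (intro exI[of _ "{i, j}"]) (auto simp: inj_off_def dest: inj_onD[of _ _ i j])
  qed auto
  then show ?thesis
    by (auto simp: closedin_def inj_off_def PiE_UNIV_domain PiE_def)
qed

text \<open>
  A common member of both sets would embed the part of \<open>I\<close> where it differs from \<open>k\<close>, and also
  the part where it differs from \<open>l\<close>, into the natural numbers; these two parts cover \<open>I\<close>.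
\<close>

lemma disjnt_inj_off:
  assumes "uncountable I" "k \<noteq> l"
  shows "disjnt (inj_off I k) (inj_off I l)"
proof -
  have "countable I" if "f \<in> inj_off I k" "f \<in> inj_off I l" for f
  proof -
    have "countable {i \<in> I. f i \<noteq> k}" "countable {i \<in> I. f i \<noteq> l}"
      using that by (auto simp: inj_off_def intro: countableI)
    moreover have "I = {i \<in> I. f i \<noteq> k} \<union> {i \<in> I. f i \<noteq> l}"
      using assms(2) by auto
    ultimately show ?thesis by (metis countable_Un)
  qed
  then show ?thesis using assms(1) by (auto simp: disjnt_def)
qed

text \<open>
  Fresh values above the old maximum enlarge the support of a finite injective labelling. This is the
  step of the recursion in Stone's argument.
\<close>

lemma inj_on_extend_finite:
  fixes f :: "'i \<Rightarrow> nat"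
  assumes "finite {i. f i \<noteq> 0}" "inj_on f {i. f i \<noteq> 0}" "finite J"
  obtains f' where "{i. f' i \<noteq> 0} = {i. f i \<noteq> 0} \<union> J" "inj_on f' {i. f' i \<noteq> 0}"
    "\<And>i. f i \<noteq> 0 \<Longrightarrow> f' i = f i"
proof -
  obtain h :: "'i \<Rightarrow> nat" where h: "inj_on h J"
    using finite_imp_inj_to_nat_seg[OF assms(3)] by blast
  have "finite (f ` {i. f i \<noteq> 0})" using assms(1) by simp
  then obtain M where M: "\<And>i. f i \<noteq> 0 \<Longrightarrow> f i \<le> M"
    unfolding finite_nat_set_iff_bounded_le by auto
  define f' where "f' i = (if f i \<noteq> 0 then f i else if i \<in> J then Suc (M + h i) else 0)" for i
  have "{i. f' i \<noteq> 0} = {i. f i \<noteq> 0} \<union> J" by (auto simp: f'_def)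
  moreover have "inj_on f' ({i. f i \<noteq> 0} \<union> J)"
  proof (rule inj_onI)
    fix i j assume *: "i \<in> {i. f i \<noteq> 0} \<union> J" "j \<in> {i. f i \<noteq> 0} \<union> J" "f' i = f' j"
    have "f i \<noteq> 0 \<longleftrightarrow> f' i \<le> M" "f j \<noteq> 0 \<longleftrightarrow> f' j \<le> M"
      using * M[of i] M[of j] by (auto simp: f'_def split: if_splits)
    then have "f i = 0 \<longleftrightarrow> f j = 0" using *(3) by metis
    then show "i = j"
      using * assms(2) h by (cases "f i = 0") (auto simp: f'_def dest: inj_onD)
  qed
  moreover have "\<And>i. f i \<noteq> 0 \<Longrightarrow> f' i = f i" by (simp add: f'_def)
  ultimately show ?thesis using that by metis
qed

text \<open>
  Suppose open sets \<open>U\<close> and \<open>V\<close> separate \<open>inj_off I 0\<close> from \<open>inj_off I 1\<close>. A function that is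
  injective on a finite support and \<open>0\<close> elsewhere belongs to \<open>inj_off I 0\<close>, hence to \<open>U\<close>, and
  finitely many coordinates witness this. Extending the labelling injectively over these coordinates,
  and repeating, gives a chain of labellings \<open>F n\<close>. Their union, continued by \<open>1\<close> instead of
  \<open>0\<close>, belongs to \<open>inj_off I 1\<close>, hence to \<open>V\<close>, by a finite set \<open>J\<close> of coordinates. Only
  finitely many of the supports are needed to exhaust the part of \<open>J\<close> that is ever labelled, say
  those up to \<open>n\<close>. The function that agrees with \<open>F n\<close> on the support of \<open>F (n + 1)\<close> and is \<open>1\<close>
  elsewhere then satisfies both finite conditions and belongs to \<open>U\<close> and \<open>V\<close>.
\<close>

theorem not_normal_nat_power:
  assumes I: "uncountable I"
  shows "\<not> normal_space (nat_power I)"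
proof
  assume "normal_space (nat_power I)"
  then obtain U V where U: "openin (nat_power I) U" "inj_off I 0 \<subseteq> U"
    and V: "openin (nat_power I) V" "inj_off I 1 \<subseteq> V" and UV: "disjnt U V"
    unfolding normal_space_def
    using closedin_inj_off[of I 0] closedin_inj_off[of I 1] disjnt_inj_off[OF I, of 0 1]
    by (metis zero_neq_one)
  \<comment> \<open>\<open>P\<close> describes the finite labellings; \<open>Q f f'\<close> says that \<open>f'\<close> extends \<open>f\<close> so far that
    agreement with \<open>f\<close> on the support of \<open>f'\<close> forces membership in \<open>U\<close>.\<close>
  define P where "P f \<longleftrightarrow> finite {i. f i \<noteq> 0} \<and> {i. f i \<noteq> 0} \<subseteq> I \<and> inj_on f {i. f i \<noteq> 0}"
    for f :: "'a \<Rightarrow> nat"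
  define Q where "Q f f' \<longleftrightarrow> {i. f i \<noteq> 0} \<subseteq> {i. f' i \<noteq> 0} \<and> (\<forall>i. f i \<noteq> 0 \<longrightarrow> f' i = f i) \<and>
      (\<forall>g\<in>extensional I. (\<forall>i. f' i \<noteq> 0 \<longrightarrow> g i = f i) \<longrightarrow> g \<in> U)" for f f' :: "'a \<Rightarrow> nat"
  have "\<exists>F. \<forall>n. P (F n) \<and> Q (F n) (F (Suc n))"
  proof (rule dependent_nat_choice)
    show "\<exists>f. P f" by (rule exI[of _ "\<lambda>_. 0"]) (simp add: P_def)
    fix f assume f: "P f"
    have "inj_on (restrict f I) {i \<in> I. restrict f I i \<noteq> 0}"
      using f by (auto simp: P_def inj_on_def)
    then have "restrict f I \<in> U"
      using U(2) by (auto simp: inj_off_def)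
    then obtain J where J: "finite J" "J \<subseteq> I"
      "\<And>g. g \<in> extensional I \<Longrightarrow> \<forall>i\<in>J. g i = restrict f I i \<Longrightarrow> g \<in> U"
      using U(1) unfolding openin_nat_power_iff by meson
    obtain f' where f': "{i. f' i \<noteq> 0} = {i. f i \<noteq> 0} \<union> J" "inj_on f' {i. f' i \<noteq> 0}"
      "\<And>i. f i \<noteq> 0 \<Longrightarrow> f' i = f i"
      using inj_on_extend_finite[of f J] f J(1) unfolding P_def by metis
    have "P f'" unfolding P_def using f f' J by (auto simp: P_def)
    moreover have "Q f f'"
      unfolding Q_def
    proof (intro conjI ballI impI)
      fix g assume g: "g \<in> extensional I" "\<forall>i. f' i \<noteq> 0 \<longrightarrow> g i = f i"
      have "g i = restrict f I i" if "i \<in> J" for i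
        using that g(2) f'(1) J(2) by auto
      then show "g \<in> U" using J(3) g(1) by blast
    qed (use f' in auto)
    ultimately show "\<exists>f'. P f' \<and> Q f f'" by blast
  qed
  then obtain F where P: "\<And>n. P (F n)" and Q: "\<And>n. Q (F n) (F (Suc n))" by blast
  have later: "F m i = F n i" if "F n i \<noteq> 0" "n \<le> m" for m n i
    using that(2,1) by (induction m rule: dec_induct) (use Q in \<open>auto simp: Q_def\<close>)
  define S where "S = {i. \<exists>n. F n i \<noteq> 0}"
  define g where "g i = (if i \<in> S then F (LEAST n. F n i \<noteq> 0) i else 1)" for i
  have g_F: "g i = F n i" if "F n i \<noteq> 0" for n i
  proof -
    have "F n i = F (LEAST n. F n i \<noteq> 0) i"
      using that by (intro later LeastI[of "\<lambda>n. F n i \<noteq> 0"] Least_le)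
    then show ?thesis using that by (auto simp: g_def S_def)
  qed
  have "inj_on g S"
  proof (rule inj_onI)
    fix i j assume ij: "i \<in> S" "j \<in> S" "g i = g j"
    obtain m n where "F m i \<noteq> 0" "F n j \<noteq> 0" using ij by (auto simp: S_def)
    then have *: "F (max m n) i \<noteq> 0" "F (max m n) j \<noteq> 0"
      using later by (metis max.cobounded1, metis max.cobounded2)
    then show "i = j"
      using ij(3) P[of "max m n"] g_F[OF *(1)] g_F[OF *(2)] by (auto simp: P_def inj_on_def)
  qed
  then have "restrict g I \<in> inj_off I 1"
    by (auto simp: inj_off_def inj_on_def g_def)
  then have "restrict g I \<in> V" using V(2) by blast
  then obtain J where J: "finite J" "J \<subseteq> I"
    "\<And>h. h \<in> extensional I \<Longrightarrow> \<forall>i\<in>J. h i = restrict g I i \<Longrightarrow> h \<in> V"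
    using V(1) unfolding openin_nat_power_iff by meson
  have "\<exists>n. \<forall>i\<in>K. F n i \<noteq> 0" if "finite K" "K \<subseteq> S" for K
    using that
  proof (induction K)
    case (insert i K)
    then obtain m n where "\<forall>j\<in>K. F n j \<noteq> 0" "F m i \<noteq> 0" by (auto simp: S_def)
    then have "\<forall>j\<in>insert i K. F (max m n) j \<noteq> 0"
      using later by (metis insert_iff max.cobounded1 max.cobounded2)
    then show ?case by blast
  qed simp
  then obtain n where n: "\<forall>i\<in>J \<inter> S. F n i \<noteq> 0"
    using J(1) by (metis finite_Int inf_le2)
  \<comment> \<open>On the support of \<open>F (n + 1)\<close> beyond that of \<open>F n\<close> the value is \<open>0\<close>, as \<open>U\<close> requires; the
    choice of \<open>n\<close> keeps \<open>J\<close> away from this part.\<close>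
  define h where "h = restrict (\<lambda>i. if F (Suc n) i \<noteq> 0 then F n i else 1) I"
  have "h \<in> U"
  proof -
    have "h i = F n i" if "F (Suc n) i \<noteq> 0" for i
      using that P[of "Suc n"] by (auto simp: h_def P_def)
    then show ?thesis using Q[of n] unfolding Q_def h_def by blast
  qed
  moreover have "h i = restrict g I i" if "i \<in> J" for i
  proof (cases "i \<in> S")
    case True
    then have "F n i \<noteq> 0" using n that by auto
    then show ?thesis using g_F[of n i] later[of n i "Suc n"] by (simp add: h_def)
  next
    case False
    then show ?thesis by (simp add: h_def g_def S_def)
  qed
  then have "h \<in> V" using J(3) by (auto simp: h_def)
  ultimately show False using UV by (auto simp: disjnt_def)
qed

section \<open>Filling a separated family of holes\<close>

lemma openin_infdist_less: "openin wijsman_topology {A \<in> CL. infdist (x :: 'a::metric_space) A < s}"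
  using openin_continuous_map_preimage[OF continuous_map_infdist_wijsman, of "{..<s}" x] by simp

lemma openin_infdist_greater: "openin wijsman_topology {A \<in> CL. s < infdist (x :: 'a::metric_space) A}"
  using openin_continuous_map_preimage[OF continuous_map_infdist_wijsman, of "{s<..}" x] by simp

lemma infdist_lessE:
  assumes "A \<in> CL" "infdist x A < s"
  obtains a where "a \<in> A" "dist x a < s"
proof -
  have ne: "A \<noteq> {}" using assms(1) by (simp add: CL_def)
  then have "(INF a\<in>A. dist x a) < s" using assms(2) by (simp add: infdist_notempty)
  then show ?thesis using that ne by (subst (asm) cINF_less_iff) auto
qed

text \<open>
  The data behind the copy of \<open>\<nat>\<^sup>C\<close>: the holes are the balls of radius \<open>r\<close> around the points of \<open>C\<close>.
  The assumption on spheres replaces connectedness; it says that each hole has points at distance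
  exactly \<open>r\<close> from its centre, which by the separation of the centres lie in no hole at all.
\<close>

locale separated_holes =
  fixes C :: "'a::metric_space set" and r :: real and p :: "'a \<Rightarrow> nat \<Rightarrow> 'a" and e :: "'a \<Rightarrow> real"
  assumes r_pos: "0 < r"
    and centres_separated: "\<lbrakk>c \<in> C; d \<in> C; c \<noteq> d\<rbrakk> \<Longrightarrow> 4 * r \<le> dist c d"
    and sphere_nonempty: "c \<in> C \<Longrightarrow> \<exists>y. dist c y = r"
    and p_near: "c \<in> C \<Longrightarrow> dist c (p c n) < r / 2"
    and e_pos: "c \<in> C \<Longrightarrow> 0 < e c"
    and p_separated: "\<lbrakk>c \<in> C; m \<noteq> n\<rbrakk> \<Longrightarrow> e c \<le> dist (p c m) (p c n)"
begin

definition outside :: "'a set"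
  where "outside = - (\<Union>c\<in>C. ball c r)"

definition fill :: "('a \<Rightarrow> nat) \<Rightarrow> 'a set"
  where "fill f = outside \<union> (\<lambda>c. p c (f c)) ` C"

lemma closed_outside: "closed outside"
  unfolding outside_def by (intro closed_Compl open_UN ballI open_ball)

lemma p_in_fill: "c \<in> C \<Longrightarrow> p c (f c) \<in> fill f"
  by (auto simp: fill_def)

lemma fill_Int_ball:
  assumes "c \<in> C" "a \<in> fill f" "dist c a < r"
  shows "a = p c (f c)"
proof -
  have "a \<notin> outside" using assms by (auto simp: outside_def)
  then obtain d where d: "d \<in> C" "a = p d (f d)" using assms(2) by (auto simp: fill_def)
  have "dist c d \<le> dist c a + dist d a" by (rule dist_triangle2)
  also have "\<dots> < 4 * r" using assms(3) p_near[OF d(1), of "f d"] d(2) r_pos by simp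
  finally have "c = d" using centres_separated[OF assms(1) d(1)] by fastforce
  then show ?thesis using d by simp
qed

lemma fill_in_CL: "fill f \<in> CL"
proof -
  have "closed ((\<lambda>c. p c (f c)) ` C)"
  proof (rule discrete_imp_closed[OF r_pos], intro ballI impI)
    fix x y assume "x \<in> (\<lambda>c. p c (f c)) ` C" "y \<in> (\<lambda>c. p c (f c)) ` C" and xy: "dist y x < r"
    then obtain c d where cd: "c \<in> C" "d \<in> C" "x = p c (f c)" "y = p d (f d)" by auto
    have "dist c d \<le> dist c x + dist x y + dist d y"
      by (metis add.assoc add_left_mono dist_commute dist_triangle dist_triangle_le)
    also have "\<dots> < 4 * r"
      using p_near[OF cd(1), of "f c"] p_near[OF cd(2), of "f d"] xy cd r_pos
      by (simp add: dist_commute)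
    finally show "y = x" using centres_separated[OF cd(1,2)] cd by fastforce
  qed
  moreover have "fill f \<noteq> {}"
    unfolding fill_def outside_def by (cases "C = {}") auto
  ultimately show ?thesis
    by (simp add: CL_def fill_def closed_outside closed_Un)
qed

text \<open>
  A point \<open>x\<close> in the hole around \<open>c\<close> has distance less than \<open>2r\<close> from the points at distance \<open>r\<close>
  from \<open>c\<close>, which belong to every filled set. Points chosen in other holes have distance at least
  \<open>4r - r - r/2\<close> from \<open>x\<close> and therefore never decide the infimum.
\<close>

lemma infdist_fill_le:
  assumes c: "c \<in> C" "dist c x < r" and eq: "f c = g c"
  shows "infdist x (fill f) \<le> infdist x (fill g)"
proof -
  have "infdist x (fill f) \<le> dist x a" if a: "a \<in> fill g" for a
  proof (cases "a \<in> fill f")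
    case False
    then obtain d where d: "d \<in> C" "a = p d (g d)" using a by (auto simp: fill_def)
    have "d \<noteq> c" using False d p_in_fill[of c f] eq by auto
    obtain y where y: "dist c y = r" using sphere_nonempty[OF c(1)] by blast
    have "y \<notin> ball b r" if "b \<in> C" for b
    proof (cases "b = c")
      case False
      have "dist c b \<le> dist c y + dist b y" by (rule dist_triangle2)
      then show ?thesis using centres_separated[OF c(1) that] False y r_pos by auto
    qed (use y in simp)
    then have "y \<in> fill f" by (auto simp: fill_def outside_def)
    then have "infdist x (fill f) \<le> dist x y" by (rule infdist_le)
    also have "\<dots> \<le> dist c x + dist c y" by (rule dist_triangle3)
    also have "\<dots> \<le> dist x a"
    proof -
      have "dist c d \<le> dist c x + dist x a + dist d a"
        by (metis add.assoc add_left_mono dist_commute dist_triangle dist_triangle_le)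
      then show ?thesis
        using centres_separated[OF c(1) d(1)] \<open>d \<noteq> c\<close> c(2) y p_near[OF d(1), of "g d"] d(2) r_pos
        by auto
    qed
    finally show ?thesis .
  qed (rule infdist_le)
  moreover have "fill g \<noteq> {}" using fill_in_CL[of g] by (simp add: CL_def)
  ultimately show ?thesis
    by (subst infdist_notempty[of "fill g"]) (auto intro: cINF_greatest)
qed

lemma infdist_fill_cong:
  assumes "c \<in> C" "dist c x < r" "f c = g c"
  shows "infdist x (fill f) = infdist x (fill g)"
  using infdist_fill_le[of c x f g] infdist_fill_le[of c x g f] assms by simp

text \<open>
  The distance from \<open>x\<close> to the filled set depends on at most one coordinate: on none if \<open>x\<close> is
  outside the holes, and otherwise on that of the hole of \<open>x\<close>.
\<close>

lemma continuous_map_fill: "continuous_map (nat_power C) wijsman_topology fill"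
  unfolding wijsman_topology_def
proof (rule continuous_on_generated_topo)
  fix W assume "W \<in> {{A \<in> CL. infdist x A \<in> U} |(x :: 'a) U. open U}"
  then obtain x U where W: "W = {A \<in> CL. infdist (x :: 'a) A \<in> U}" by blast
  have local: "\<exists>J. finite J \<and> J \<subseteq> C \<and>
      (\<forall>g\<in>extensional C. (\<forall>c\<in>J. g c = f c) \<longrightarrow> infdist x (fill g) = infdist x (fill f))" for f
  proof (cases "x \<in> outside")
    case True
    then have "infdist x (fill h) = 0" for h by (simp add: fill_def)
    then show ?thesis by auto
  next
    case False
    then obtain c where "c \<in> C" "dist c x < r" by (auto simp: outside_def)
    then have "infdist x (fill g) = infdist x (fill f)" if "g c = f c" for g
      using infdist_fill_cong that by blast
    then show ?thesis using \<open>c \<in> C\<close> by (intro exI[of _ "{c}"]) blast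
  qed
  have preimage: "fill -` W \<inter> topspace (nat_power C) = {f \<in> extensional C. infdist x (fill f) \<in> U}"
    by (auto simp: W fill_in_CL PiE_def)
  show "openin (nat_power C) (fill -` W \<inter> topspace (nat_power C))"
    unfolding openin_nat_power_iff preimage
  proof (intro conjI ballI)
    fix f assume f: "f \<in> {f \<in> extensional C. infdist x (fill f) \<in> U}"
    obtain J where J: "finite J" "J \<subseteq> C"
      "\<And>g. g \<in> extensional C \<Longrightarrow> \<forall>c\<in>J. g c = f c \<Longrightarrow> infdist x (fill g) = infdist x (fill f)"
      using local by meson
    show "\<exists>J. finite J \<and> J \<subseteq> C \<and> (\<forall>g\<in>extensional C.
        (\<forall>c\<in>J. g c = f c) \<longrightarrow> g \<in> {f \<in> extensional C. infdist x (fill f) \<in> U})"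
      by (intro exI[of _ J] conjI ballI impI J(1,2)) (metis (mono_tags, lifting) f J(3) mem_Collect_eq)
  qed auto
next
  have "\<Union> {{A \<in> CL. infdist x A \<in> U} |(x :: 'a) U. open U} = CL" by (auto intro: open_UNIV)
  then show "fill ` topspace (nat_power C) \<subseteq> \<Union> {{A \<in> CL. infdist x A \<in> U} |(x :: 'a) U. open U}"
    using fill_in_CL by auto
qed

lemma inj_on_fill: "inj_on fill (topspace (nat_power C))"
proof (rule inj_onI)
  fix f g assume fg: "f \<in> topspace (nat_power C)" "g \<in> topspace (nat_power C)" "fill f = fill g"
  have "f c = g c" if c: "c \<in> C" for c
  proof -
    have "p c (f c) \<in> fill g" using p_in_fill[OF c, of f] fg(3) by simp
    then have "p c (f c) = p c (g c)" using fill_Int_ball[OF c] p_near[OF c, of "f c"] r_pos by auto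
    then show ?thesis using p_separated[OF c, of "f c" "g c"] e_pos[OF c] by auto
  qed
  then show "f = g" using fg by (auto simp: PiE_iff intro: extensionalityI)
qed

text \<open>
  The coordinates of \<open>f\<close> can be read off from the filled set by open conditions: the bound \<open>r/2\<close>
  keeps a nearby point in the hole of \<open>c\<close>, and the bound \<open>e c\<close> identifies it in the sequence.
\<close>

lemma infdist_p_fill_small:
  assumes c: "c \<in> C" and less: "infdist (p c n) (fill f) < min (e c) (r / 2)"
  shows "f c = n"
proof -
  obtain a where a: "a \<in> fill f" "dist (p c n) a < min (e c) (r / 2)"
    using infdist_lessE[OF fill_in_CL less] by blast
  have "dist c a \<le> dist c (p c n) + dist (p c n) a" by (rule dist_triangle)
  also have "\<dots> < r" using a(2) p_near[OF c, of n] by auto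
  finally have "a = p c (f c)" using fill_Int_ball[OF c a(1)] by simp
  then show ?thesis using a(2) p_separated[OF c, of n "f c"] by fastforce
qed

lemma closed_range_p:
  assumes c: "c \<in> C"
  shows "closed (range (p c))"
proof (rule discrete_imp_closed[OF e_pos[OF c]], clarify)
  fix m n assume "dist (p c n) (p c m) < e c"
  then have "n = m" using p_separated[OF c, of n m] by fastforce
  then show "p c n = p c m" by simp
qed

text \<open>
  A limit of filled sets is a filled set. Its properties are found one at a time, by testing it
  against suitable open sets of the Wijsman topology: those that contain the limit must contain a
  filled set.
\<close>

context
  fixes F :: "('a \<Rightarrow> nat) set" and B :: "'a set"
  assumes B: "B \<in> wijsman_topology closure_of (fill ` F)"
begin

lemma limit_in_CL: "B \<in> CL"
  using B by (simp add: in_closure_of)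

lemma limit_meets:
  assumes "openin wijsman_topology W" "B \<in> W"
  obtains f where "f \<in> F" "fill f \<in> W"
  using B assms by (auto simp: in_closure_of)

lemma outside_subset_limit: "outside \<subseteq> B"
proof
  fix y assume y: "y \<in> outside"
  show "y \<in> B"
  proof (rule ccontr)
    assume "y \<notin> B"
    then have "0 < infdist y B"
      using limit_in_CL by (intro infdist_pos_not_in_closed) (auto simp: CL_def)
    then obtain f where "0 < infdist y (fill f)"
      using limit_meets[OF openin_infdist_greater, of 0 y] limit_in_CL by auto
    then show False using y by (simp add: fill_def)
  qed
qed

lemma limit_Int_ball:
  assumes c: "c \<in> C" and b: "b \<in> B" "dist c b < r"
  shows "b \<in> range (p c)"
proof -
  have "\<exists>y\<in>range (p c). dist y b < \<delta>" if "0 < \<delta>" for \<delta>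
  proof -
    let ?\<eta> = "min \<delta> (r - dist c b)"
    have "infdist b B < ?\<eta>" using b that by simp
    then obtain f where "infdist b (fill f) < ?\<eta>"
      using limit_meets[OF openin_infdist_less, of b ?\<eta>] limit_in_CL by auto
    then obtain a where a: "a \<in> fill f" "dist b a < ?\<eta>"
      using infdist_lessE[OF fill_in_CL] by metis
    have "dist c a \<le> dist c b + dist b a" by (rule dist_triangle)
    then have "a = p c (f c)" using fill_Int_ball[OF c a(1)] a(2) by simp
    then show ?thesis using a(2) by (auto simp: dist_commute)
  qed
  then have "b \<in> closure (range (p c))" by (simp add: closure_approachable)
  then show ?thesis using closed_range_p[OF c] by (simp add: closure_closed)
qed

text \<open>
  The distance from the centre \<open>c\<close> to a filled set is at most \<open>r/2\<close>, which survives in the limit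
  and keeps the hole from becoming empty.
\<close>

lemma limit_contains_p:
  assumes c: "c \<in> C"
  shows "\<exists>n. p c n \<in> B"
proof -
  have "infdist c B \<le> r / 2"
  proof (rule ccontr)
    assume "\<not> infdist c B \<le> r / 2"
    then obtain f where "r / 2 < infdist c (fill f)"
      using limit_meets[OF openin_infdist_greater, of "r / 2" c] limit_in_CL by auto
    then show False using infdist_le[OF p_in_fill[OF c], of c f] p_near[OF c, of "f c"] by simp
  qed
  then obtain b where "b \<in> B" "dist c b < r"
    using infdist_lessE[OF limit_in_CL, of c r] r_pos by auto
  then show ?thesis using limit_Int_ball[OF c] by blast
qed

text \<open>
  Using pairs instead of a function on a finite set of centres lets the same lemma show that the
  limit has one point per hole (two pairs with the same centre) and that the labelling of the limit
  lies in the closure of \<open>F\<close>.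
\<close>

lemma limit_finite_choice:
  assumes K: "finite K" "\<And>c n. (c, n) \<in> K \<Longrightarrow> c \<in> C \<and> p c n \<in> B"
  obtains f where "f \<in> F" "\<And>c n. (c, n) \<in> K \<Longrightarrow> f c = n"
proof -
  let ?N = "\<lambda>(c, n). {A \<in> CL. infdist (p c n) A < min (e c) (r / 2)}"
  have "openin wijsman_topology (topspace wijsman_topology \<inter> \<Inter> (?N ` K))"
  proof (rule openin_Int_Inter)
    show "openin wijsman_topology A" if "A \<in> ?N ` K" for A
      using that openin_infdist_less by (auto simp del: min_less_iff_conj)
  qed (use K(1) in \<open>simp_all del: topspace_wijsman\<close>)
  moreover have "B \<in> topspace wijsman_topology \<inter> \<Inter> (?N ` K)"
  proof (intro IntI INT_I; clarsimp)
    fix c n assume "(c, n) \<in> K"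
    then show "B \<in> CL \<and> infdist (p c n) B < e c \<and> infdist (p c n) B * 2 < r"
      using K(2)[of c n] limit_in_CL e_pos[of c] r_pos by simp
  qed (rule limit_in_CL)
  ultimately obtain f where "f \<in> F" "fill f \<in> topspace wijsman_topology \<inter> \<Inter> (?N ` K)"
    by (rule limit_meets)
  then have f: "f \<in> F" "fill f \<in> \<Inter> (?N ` K)" by simp_all
  have "f c = n" if "(c, n) \<in> K" for c n
  proof (rule infdist_p_fill_small)
    show "c \<in> C" using K(2)[OF that] by simp
    have "fill f \<in> ?N (c, n)" using f(2) that by blast
    then show "infdist (p c n) (fill f) < min (e c) (r / 2)" by simp
  qed
  then show ?thesis using that f(1) by blast
qed

lemma limit_eq_fill:
  obtains f where "f \<in> extensional C" "B = fill f"
proof -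
  obtain h where h: "\<And>c. c \<in> C \<Longrightarrow> p c (h c) \<in> B"
    using limit_contains_p by (metis (no_types))
  have uniq: "n = h c" if "c \<in> C" "p c n \<in> B" for c n
  proof -
    obtain f where "f \<in> F" "\<And>d m. (d, m) \<in> {(c, n), (c, h c)} \<Longrightarrow> f d = m"
      by (rule limit_finite_choice[of "{(c, n), (c, h c)}"]) (use \<open>c \<in> C\<close> \<open>p c n \<in> B\<close> h in auto)
    then have "f c = n" "f c = h c" by blast+
    then show ?thesis by simp
  qed
  have "b \<in> fill (restrict h C)" if b: "b \<in> B" for b
  proof (cases "b \<in> outside")
    case False
    then obtain c where c: "c \<in> C" "dist c b < r" by (auto simp: outside_def)
    then obtain n where n: "b = p c n" using limit_Int_ball b by blast
    then have "n = h c" using uniq c b by blast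
    then show ?thesis using n c p_in_fill[of c "restrict h C"] by simp
  qed (simp add: fill_def)
  moreover have "fill (restrict h C) \<subseteq> B"
    using outside_subset_limit h by (auto simp: fill_def)
  ultimately show ?thesis using that[of "restrict h C"] by auto
qed

end

lemma closed_map_fill: "closed_map (nat_power C) wijsman_topology fill"
  unfolding closed_map_def
proof (intro allI impI)
  fix F assume F: "closedin (nat_power C) F"
  then have F_open: "openin (nat_power C) (extensional C - F)"
    by (auto simp: closedin_def PiE_def)
  have "B \<in> fill ` F" if B: "B \<in> wijsman_topology closure_of (fill ` F)" for B
  proof -
    obtain f where f: "f \<in> extensional C" "B = fill f" using limit_eq_fill[OF B] by blast
    have "f \<in> F"
    proof (rule ccontr)
      assume "f \<notin> F"
      then obtain J where J: "finite J" "J \<subseteq> C"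
        "\<And>g. g \<in> extensional C \<Longrightarrow> \<forall>c\<in>J. g c = f c \<Longrightarrow> g \<in> extensional C - F"
        using F_open f(1) unfolding openin_nat_power_iff by (meson DiffI)
      obtain g where "g \<in> F" "\<And>c n. (c, n) \<in> (\<lambda>c. (c, f c)) ` J \<Longrightarrow> g c = n"
        by (rule limit_finite_choice[OF B, of "(\<lambda>c. (c, f c)) ` J"]) (use J(1,2) f(2) p_in_fill in auto)
      moreover have "g \<in> extensional C"
        using closedin_subset[OF F] \<open>g \<in> F\<close> by (auto simp: PiE_def)
      ultimately show False using J(3)[of g] by blast
    qed
    then show ?thesis using f(2) by blast
  qed
  then show "closedin wijsman_topology (fill ` F)"
    using fill_in_CL
    by (metis (no_types, lifting) closure_of_subset_eq image_subset_iff subsetI topspace_wijsman)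
qed

theorem normal_nat_power:
  assumes "normal_space (wijsman_topology :: 'a set topology)"
  shows "normal_space (nat_power C)"
proof -
  have "nat_power C homeomorphic_space
      subtopology wijsman_topology (fill ` topspace (nat_power C))"
    by (intro embedding_map_imp_homeomorphic_space injective_closed_imp_embedding_map
        continuous_map_fill closed_map_fill inj_on_fill)
  moreover have "closedin wijsman_topology (fill ` topspace (nat_power C))"
    using closed_map_fill closedin_topspace unfolding closed_map_def by blast
  ultimately show ?thesis
    using normal_space_closed_subtopology[OF assms] homeomorphic_normal_space by blast
qed

end

section \<open>Separability in linear metric spaces\<close>

text \<open>
  If maximal \<open>\<epsilon>\<close>-separated subsets were countable for all \<open>\<epsilon>\<close> of the form \<open>1/(n+1)\<close>, the union
  of one such subset for each \<open>n\<close> would be countable and dense. The lemma serves both for the centres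
  of the holes and for the sequences inside them.
\<close>

lemma uncountable_separated_subset:
  fixes S :: "'a::metric_space set"
  assumes nonsep: "\<And>T. countable T \<Longrightarrow> T \<subseteq> S \<Longrightarrow> \<not> S \<subseteq> closure T"
  obtains \<epsilon> T where "0 < \<epsilon>" "uncountable T" "T \<subseteq> S" "\<And>x y. \<lbrakk>x \<in> T; y \<in> T; x \<noteq> y\<rbrakk> \<Longrightarrow> \<epsilon> \<le> dist x y"
proof -
  define \<A> where "\<A> \<epsilon> = {T. T \<subseteq> S \<and> (\<forall>x\<in>T. \<forall>y\<in>T. x \<noteq> y \<longrightarrow> \<epsilon> \<le> dist x y)}" for \<epsilon>
  have "\<exists>M\<in>\<A> \<epsilon>. \<forall>T\<in>\<A> \<epsilon>. M \<subseteq> T \<longrightarrow> T = M" for \<epsilon>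
  proof (rule subset_Zorn')
    fix \<C> assume chain: "subset.chain (\<A> \<epsilon>) \<C>"
    have "\<epsilon> \<le> dist x y" if "x \<in> \<Union>\<C>" "y \<in> \<Union>\<C>" "x \<noteq> y" for x y
    proof -
      obtain X Y where XY: "X \<in> \<C>" "x \<in> X" "Y \<in> \<C>" "y \<in> Y" using \<open>x \<in> \<Union>\<C>\<close> \<open>y \<in> \<Union>\<C>\<close> by blast
      have "X \<union> Y \<in> \<C>"
        using chain XY unfolding subset_chain_def by (metis subset_Un_eq sup.commute)
      then show ?thesis
        using chain XY \<open>x \<noteq> y\<close> unfolding subset_chain_def \<A>_def by blast
    qed
    then show "\<Union>\<C> \<in> \<A> \<epsilon>"
      using chain unfolding subset_chain_def \<A>_def by blast
  qed
  then obtain M where M: "\<And>\<epsilon>. M \<epsilon> \<in> \<A> \<epsilon>" and max: "\<And>\<epsilon> T. T \<in> \<A> \<epsilon> \<Longrightarrow> M \<epsilon> \<subseteq> T \<Longrightarrow> T = M \<epsilon>"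
    by metis
  have close: "\<exists>y\<in>M \<epsilon>. dist y x < \<epsilon>" if "x \<in> S" "0 < \<epsilon>" for x \<epsilon>
  proof (rule ccontr)
    assume far: "\<not> (\<exists>y\<in>M \<epsilon>. dist y x < \<epsilon>)"
    then have "insert x (M \<epsilon>) \<in> \<A> \<epsilon>"
      using M[of \<epsilon>] \<open>x \<in> S\<close> by (auto simp: \<A>_def not_less dist_commute)
    then have "x \<in> M \<epsilon>" using max by blast
    then show False using far \<open>0 < \<epsilon>\<close> by auto
  qed
  let ?D = "\<Union>n. M (inverse (real (Suc n)))"
  have "S \<subseteq> closure ?D"
  proof
    fix x assume x: "x \<in> S"
    show "x \<in> closure ?D"
      unfolding closure_approachable
    proof (intro allI impI)
      fix \<epsilon> :: real assume "0 < \<epsilon>"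
      then obtain n where n: "inverse (real (Suc n)) < \<epsilon>" using reals_Archimedean by blast
      obtain y where "y \<in> M (inverse (real (Suc n)))" "dist y x < inverse (real (Suc n))"
        using close[OF x, of "inverse (real (Suc n))"] by auto
      then show "\<exists>y\<in>?D. dist y x < \<epsilon>" using n by force
    qed
  qed
  moreover have "?D \<subseteq> S" using M by (auto simp: \<A>_def)
  ultimately have "uncountable ?D" using nonsep by blast
  then obtain n where n: "uncountable (M (inverse (real (Suc n))))" by auto
  show ?thesis
    by (rule that[of "inverse (real (Suc n))", OF _ n]) (use M[of "inverse (real (Suc n))"] in \<open>auto simp: \<A>_def\<close>)
qed

context linear_metric_space
begin

lemma continuous_scale_left: "continuous_on UNIV (\<lambda>t. scale t x)"
  using continuous_on_compose2[OF continuous_scale, of UNIV "\<lambda>t. (t, x)"]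
  by (simp add: continuous_on_Pair continuous_on_const continuous_on_id)

lemma continuous_scale_right: "continuous_on UNIV (scale t)"
  using continuous_on_compose2[OF continuous_scale, of UNIV "\<lambda>x. (t, x)"]
  by (simp add: continuous_on_Pair continuous_on_const continuous_on_id)

lemma continuous_add_right: "continuous_on UNIV (\<lambda>x :: 'a. x + a)"
  using continuous_on_compose2[OF continuous_add, of UNIV "\<lambda>x. (x, a :: 'a)"]
  by (simp add: continuous_on_Pair continuous_on_const continuous_on_id)

text \<open>
  The intermediate value theorem along the segment from \<open>c\<close> to \<open>d\<close>.
\<close>

lemma sphere_nonempty:
  fixes c d :: 'a
  assumes "0 \<le> r" "r \<le> dist c d"
  shows "\<exists>y. dist c y = r"
proof -
  let ?\<gamma> = "\<lambda>t::real. scale (of_real t) (d - c) + c"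
  have "continuous_on UNIV (\<lambda>t::real. scale (of_real t) (d - c))"
    by (rule continuous_on_compose2[OF continuous_scale_left]) (auto intro!: continuous_intros)
  then have "continuous_on UNIV ?\<gamma>"
    by (rule continuous_on_compose2[OF continuous_add_right]) auto
  then have "continuous_on {0..1} (\<lambda>t. dist c (?\<gamma> t))"
    by (rule continuous_on_dist[OF continuous_on_const continuous_on_subset]) simp
  then have "\<exists>t\<ge>0. t \<le> 1 \<and> dist c (?\<gamma> t) = r"
    using assms by (intro IVT') auto
  then show ?thesis by blast
qed

text \<open>
  For each \<open>x\<close> the points \<open>x/n + c\<close> tend to \<open>c\<close>, so one of them lies in the ball. The map
  \<open>y \<mapsto> n(y - c)\<close> sends it back to \<open>x\<close>, and by continuity sends points of \<open>T\<close> close to \<open>x\<close>.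
\<close>

lemma separable_if_ball_separable:
  fixes c :: 'a
  assumes "0 < \<delta>" and T: "countable T" "ball c \<delta> \<subseteq> closure T"
  shows "separable_space (euclidean :: 'a topology)"
proof -
  define h where "h n x = scale (of_nat n) (x + - c)" for n x
  let ?D = "\<Union>n. h n ` T"
  have cont: "continuous_on UNIV (h n)" for n
    unfolding h_def
    by (rule continuous_on_compose2[OF continuous_scale_right continuous_add_right]) auto
  have "x \<in> closure ?D" for x
    unfolding closure_iff_nhds_not_empty
  proof (intro allI impI)
    fix A W assume W: "W \<subseteq> A" "open W" "x \<in> W"
    have "(\<lambda>n. inverse (of_nat n) :: 'k) \<longlonglongrightarrow> 0" by (rule lim_inverse_n)
    then have "(\<lambda>n. scale (inverse (of_nat n)) x) \<longlonglongrightarrow> scale 0 x"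
      by (rule continuous_on_tendsto_compose[OF continuous_scale_left]) simp_all
    then have "(\<lambda>n. scale (inverse (of_nat n)) x + c) \<longlonglongrightarrow> scale 0 x + c"
      by (rule continuous_on_tendsto_compose[OF continuous_add_right]) simp_all
    then have "\<forall>\<^sub>F n in sequentially. dist (scale (inverse (of_nat n)) x + c) c < \<delta>"
      using tendstoD \<open>0 < \<delta>\<close> by fastforce
    then obtain n where n: "0 < n" "dist (scale (inverse (of_nat n)) x + c) c < \<delta>"
      using eventually_happens'[OF sequentially_bot eventually_conj[OF eventually_gt_at_top[of 0]]] by blast
    let ?z = "scale (inverse (of_nat n)) x + c"
    have "h n ?z = x" using n(1) by (simp add: h_def)
    then have "?z \<in> ball c \<delta> \<inter> h n -` W" using n W by (simp add: dist_commute)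
    moreover have "open (ball c \<delta> \<inter> h n -` W)"
      using cont W(2) by (intro open_Int open_ball open_vimage)
    moreover have "?z \<in> closure T" using calculation(1) T(2) by blast
    ultimately obtain y where "y \<in> T" "h n y \<in> W"
      using closure_iff_nhds_not_empty[of ?z T] by blast
    then show "?D \<inter> A \<noteq> {}" using W(1) by blast
  qed
  then have "closure ?D = UNIV" by blast
  moreover have "countable ?D" using T(1) by simp
  ultimately show ?thesis unfolding separable_space_def by (intro exI[of _ ?D]) simp
qed

lemma separated_holes_if_not_separable:
  assumes nonsep: "\<not> separable_space (euclidean :: 'a topology)"
  obtains C :: "'a set" and r p e where "uncountable C" "separated_holes C r p e"
proof -
  obtain \<epsilon> and C :: "'a set" where C: "0 < \<epsilon>" "uncountable C" "\<And>x y. \<lbrakk>x \<in> C; y \<in> C; x \<noteq> y\<rbrakk> \<Longrightarrow> \<epsilon> \<le> dist x y"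
  proof (rule uncountable_separated_subset[of "UNIV :: 'a set"])
    fix T :: "'a set" assume "countable T"
    then show "\<not> UNIV \<subseteq> closure T"
      using nonsep by (auto simp: separable_space_def top.extremum_unique)
  qed (rule that)
  define r where "r = \<epsilon> / 4"
  have r: "0 < r" using C(1) by (simp add: r_def)
  have "\<exists>q \<delta>. (\<forall>n::nat. dist c (q n) < r / 2) \<and> 0 < \<delta> \<and>
      (\<forall>m n. m \<noteq> n \<longrightarrow> \<delta> \<le> dist (q m) (q n))" for c :: 'a
  proof -
    obtain \<delta> T where T: "0 < \<delta>" "uncountable T" "T \<subseteq> ball c (r / 2)"
      "\<And>x y. \<lbrakk>x \<in> T; y \<in> T; x \<noteq> y\<rbrakk> \<Longrightarrow> \<delta> \<le> dist x y"
      using uncountable_separated_subset[of "ball c (r / 2)"] separable_if_ball_separable[of "r / 2" _ c]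
        nonsep r by (metis half_gt_zero)
    obtain q :: "nat \<Rightarrow> 'a" where q: "inj q" "range q \<subseteq> T"
      using infinite_countable_subset uncountable_infinite[OF T(2)] by blast
    have "dist c (q n) < r / 2" for n
      using subsetD[OF T(3), of "q n"] q(2) by auto
    moreover have "\<delta> \<le> dist (q m) (q n)" if "m \<noteq> n" for m n
      using T(4)[of "q m" "q n"] q that by (auto simp: inj_eq)
    ultimately show ?thesis using T(1) by blast
  qed
  then obtain p :: "'a \<Rightarrow> nat \<Rightarrow> 'a" and e where pe: "\<And>c n. dist c (p c n) < r / 2" "\<And>c. 0 < e c"
    "\<And>c m n. m \<noteq> n \<Longrightarrow> e c \<le> dist (p c m) (p c n)"
    by metis
  have "\<exists>y. dist c y = r" if "c \<in> C" for c
  proof -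
    have "infinite (C - {c})" using C(2) uncountable_infinite by auto
    then obtain d where "d \<in> C" "d \<noteq> c" by (metis Diff_iff finite.emptyI insertCI equals0I)
    then show ?thesis using sphere_nonempty[of r c d] C(3)[OF that, of d] r by (auto simp: r_def)
  qed
  then have "separated_holes C r p e"
    using r pe C(3) by unfold_locales (auto simp: r_def)
  then show ?thesis using that C(2) by blast
qed

end

theorem corollary5p18:
  fixes scale :: "'k::real_normed_field \<Rightarrow> 'a::{ab_group_add, metric_space} \<Rightarrow> 'a"
  assumes "linear_metric_space scale"
    and "normal_space (wijsman_topology :: 'a set topology)"
  shows "separable_space (euclidean :: 'a topology)"
proof (rule ccontr)
  interpret linear_metric_space scale by fact
  assume "\<not> separable_space (euclidean :: 'a topology)"
  then obtain C :: "'a set" and r p e where C: "uncountable C" "separated_holes C r p e"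
    using separated_holes_if_not_separable by blast
  show False
    using not_normal_nat_power[OF C(1)] separated_holes.normal_nat_power[OF C(2) assms(2)] by blast
qed

end
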